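(* Let $f_{\mathrm{base}}$ be a frozen $L$-layer decoder embedding model, let $\mathcal{M}$ be a finite set of packs (per-layer adapter stacks with binary gates $g_m$, $m\in\mathcal{M}$, and arbitrary adapter parameters), and let $f$ be the model obtained from $f_{\mathrm{base}}$ by attaching all the packs in $\mathcal{M}$ through their gated layer hooks. Fix an input $x$ and suppose that exactly one pack $m^\star\in\mathcal{M}$ has $g_{m^\star}(x)=1$, while $g_m(x)=0$ for every $m\in\mathcal{M}\setminus\{m^\star\}$. Then $f(x)=f_{m^\star}(x)$ exactly, where $f_{m^\star}$ is the model obtained from $f_{\mathrm{base}}$ by attaching the pack $m^\star$ alone.
   Context: Base model. $f_{\mathrm{base}}$ is a fixed (frozen) decoder model: an input $x$ is mapped by an input stage to hidden states $h_0\in\mathbb{R}^{n\times d}$ ($n$ depends on $x$), decoder layers $F_1,\dots,F_L$ are applied in order, $h_\ell=F_\ell(h_{\ell-1})$, and an output stage (pooling/readout) maps the final hidden states to the embedding. (In the paper's instance $L=28$, $d=2048$.) All base weights are fixed and shared by every model considered, and the input stage producing $h_0$ from $x$ is the same for $f$ and for $f_{m^\star}$. Adapters. A bottleneck adapter at layer $\ell$ of rank $r$ is the map, applied to each of the $n$ rows (viewed as column vectors in $\mathbb{R}^d$), $$A_\ell(h)=W^{\mathrm{up}}_\ell\,\sigma\bigl(W^{\mathrm{down}}_\ell\,\mathrm{LN}(h)\bigr),\qquad W^{\mathrm{down}}_\ell\in\mathbb{R}^{r\times d},\ W^{\mathrm{up}}_\ell\in\mathbb{R}^{d\times r},$$ where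 $\sigma$ is the SiLU nonlinearity and $\mathrm{LN}$ is a LayerNorm. Packs, gates, hooks. A pack $m$ consists of one such adapter $A^{(m)}_\ell$ for every layer $\ell=1,\dots,L$, with arbitrary parameter values (e.g. after arbitrary training), together with a binary gate $g_m(x)\in\{0,1\}$, which is a fixed function of the input $x$. Attaching pack $m$ registers at every layer $\ell$ a gated hook that is run on the layer's output $h_\ell$: if $g_m(x)=1$ the hook replaces $h_\ell$ by $h_\ell+A^{(m)}_\ell(h_\ell)$; if $g_m(x)=0$ the hook returns immediately, before performing any adapter operation, and $h_\ell$ is passed on unchanged. When several packs are attached, their hooks at a given layer are run one after another in a fixed registration order, each on the value left by the previous one, and the result is fed to layer $\ell+1$ (or to the output stage if $\ell=L$). The hooks are the only modifications made to the base model. The pack $m^\star$ has the same gate and the same adapter parameters in $f$ and in $f_{m^\star}$. All models are run under the same fixed inference configuration (same precision, kernels and batch composition), so that each numerical operation is a deterministic function of its operands; "exactly" means equality of outputs, not approximate equality. *)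

theory Defs
  imports Complex_Main "Jordan_Normal_Form.Matrix"
begin

definition silu :: "real \<Rightarrow> real" where
  "silu t = t / (1 + exp (- t))"

record norm_params =
  ln_gain :: "real vec"
  ln_bias :: "real vec"
  ln_eps :: real

definition layer_norm :: "norm_params \<Rightarrow> real vec \<Rightarrow> real vec" where
  "layer_norm q v =
    (let d = dim_vec v;
         \<mu> = (\<Sum>i<d. v $ i) / real d;
         var = (\<Sum>i<d. (v $ i - \<mu>)\<^sup>2) / real d
     in vec d (\<lambda>i. ln_gain q $ i * ((v $ i - \<mu>) / sqrt (var + ln_eps q)) + ln_bias q $ i))"

text \<open>
  An inference configuration (precision, kernels, batch composition) determines the value that
  each numerical operation returns as a function of its operands.  It is recorded as the
  entrywise deviation from the exact real result.  The deviations are unrestricted, so every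
  deterministic real-valued kernel of the right shape is covered; all deviations being 0 is exact
  real arithmetic.  The operands are whole hidden-state matrices (one row per position), since a
  kernel may treat a row differently depending on the other rows.
\<close>

record inference_config =
  ln_dev :: "norm_params \<Rightarrow> real mat \<Rightarrow> nat \<times> nat \<Rightarrow> real"
  linear_dev :: "real mat \<Rightarrow> real mat \<Rightarrow> nat \<times> nat \<Rightarrow> real"
  silu_dev :: "real mat \<Rightarrow> nat \<times> nat \<Rightarrow> real"
  add_dev :: "real mat \<Rightarrow> real mat \<Rightarrow> nat \<times> nat \<Rightarrow> real"

definition exact_config :: inference_config where
  "exact_config =
    \<lparr>ln_dev = (\<lambda>_ _ _. 0), linear_dev = (\<lambda>_ _ _. 0), silu_dev = (\<lambda>_ _. 0), add_dev = (\<lambda>_ _ _. 0)\<rparr>"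

definition computed :: "(nat \<times> nat \<Rightarrow> real) \<Rightarrow> real mat \<Rightarrow> real mat" where
  "computed e A = mat (dim_row A) (dim_col A) (\<lambda>ij. A $$ ij + e ij)"

definition map_rows :: "nat \<Rightarrow> (real vec \<Rightarrow> real vec) \<Rightarrow> real mat \<Rightarrow> real mat" where
  "map_rows k g h = mat (dim_row h) k (\<lambda>(i, j). g (row h i) $ j)"

definition run_layer_norm :: "inference_config \<Rightarrow> norm_params \<Rightarrow> real mat \<Rightarrow> real mat" where
  "run_layer_norm c q h = computed (ln_dev c q h) (map_rows (dim_col h) (layer_norm q) h)"

definition run_linear :: "inference_config \<Rightarrow> real mat \<Rightarrow> real mat \<Rightarrow> real mat" where
  "run_linear c W h = computed (linear_dev c W h) (map_rows (dim_row W) (\<lambda>v. W *\<^sub>v v) h)"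

definition run_silu :: "inference_config \<Rightarrow> real mat \<Rightarrow> real mat" where
  "run_silu c h = computed (silu_dev c h) (map_mat silu h)"

definition run_add :: "inference_config \<Rightarrow> real mat \<Rightarrow> real mat \<Rightarrow> real mat" where
  "run_add c h k = computed (add_dev c h k) (h + k)"

record adapter =
  W_down :: "real mat"
  W_up :: "real mat"
  ln :: norm_params

definition wf_adapter :: "nat \<Rightarrow> adapter \<Rightarrow> bool" where
  "wf_adapter d a \<longleftrightarrow>
    (\<exists>r. W_down a \<in> carrier_mat r d \<and> W_up a \<in> carrier_mat d r) \<and>
    ln_gain (ln a) \<in> carrier_vec d \<and> ln_bias (ln a) \<in> carrier_vec d \<and> ln_eps (ln a) \<ge> 0"

definition run_adapter :: "inference_config \<Rightarrow> adapter \<Rightarrow> real mat \<Rightarrow> real mat" where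
  "run_adapter c a h =
    run_linear c (W_up a) (run_silu c (run_linear c (W_down a) (run_layer_norm c (ln a) h)))"

lemma row_run_adapter_exact:
  assumes "wf_adapter d a" "h \<in> carrier_mat n d" "i < n"
  shows "row (run_adapter exact_config a h) i =
    W_up a *\<^sub>v map_vec silu (W_down a *\<^sub>v layer_norm (ln a) (row h i))"
proof -
  have computed0: "computed (\<lambda>_. 0) A = A" for A
    by (auto simp: computed_def)
  have row_map_rows: "row (map_rows k g A) i = g (row A i)"
    if "i < dim_row A" "dim_vec (g (row A i)) = k" for k g A
    using that by (auto simp: map_rows_def)
  have dim_map_rows: "dim_row (map_rows k g A) = dim_row A" for k g A
    by (simp add: map_rows_def)
  have dim_ln: "dim_vec (layer_norm q v) = dim_vec v" for q v
    by (simp add: layer_norm_def Let_def)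
  have row_map: "row (map_mat silu A) i = map_vec silu (row A i)" if "i < dim_row A" for A
    using that by auto
  show ?thesis
    using assms
    by (simp add: run_adapter_def run_linear_def run_silu_def run_layer_norm_def exact_config_def
        computed0 row_map_rows dim_map_rows dim_ln row_map)
qed

text \<open>Inputs are of an arbitrary type \<open>'x\<close>; the adapters are indexed by the layers \<open>1, \<dots>, L\<close>.\<close>

record 'x pack =
  gate :: "'x \<Rightarrow> bool"
  adapter_at :: "nat \<Rightarrow> adapter"

definition wf_pack :: "nat \<Rightarrow> nat \<Rightarrow> 'x pack \<Rightarrow> bool" where
  "wf_pack L d p \<longleftrightarrow> (\<forall>l\<in>{1..L}. wf_adapter d (adapter_at p l))"

definition gated_hook :: "inference_config \<Rightarrow> 'x pack \<Rightarrow> 'x \<Rightarrow> nat \<Rightarrow> real mat \<Rightarrow> real mat" where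
  "gated_hook c p x l h =
    (if gate p x then run_add c h (run_adapter c (adapter_at p l) h) else h)"

record 'x decoder =
  num_layers :: nat
  width :: nat
  seq_len :: "'x \<Rightarrow> nat"
  input_stage :: "'x \<Rightarrow> real mat"
  decoder_layer :: "nat \<Rightarrow> real mat \<Rightarrow> real mat"
  output_stage :: "real mat \<Rightarrow> real vec"

text \<open>
  The layers and the output stage are arbitrary functions, namely the ones computed with the frozen
  weights under the given inference configuration.
\<close>

definition wf_decoder :: "'x decoder \<Rightarrow> bool" where
  "wf_decoder B \<longleftrightarrow>
    (\<forall>x. input_stage B x \<in> carrier_mat (seq_len B x) (width B)) \<and>
    (\<forall>l\<in>{1..num_layers B}. \<forall>n. \<forall>h\<in>carrier_mat n (width B).
      decoder_layer B l h \<in> carrier_mat n (width B))"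

primrec hidden_state ::
  "'x decoder \<Rightarrow> (nat \<Rightarrow> (real mat \<Rightarrow> real mat) list) \<Rightarrow> 'x \<Rightarrow> nat \<Rightarrow> real mat" where
  "hidden_state B hooks x 0 = input_stage B x"
| "hidden_state B hooks x (Suc l) =
    fold (\<lambda>hook h. hook h) (hooks (Suc l)) (decoder_layer B (Suc l) (hidden_state B hooks x l))"

definition run_hooked ::
  "'x decoder \<Rightarrow> (nat \<Rightarrow> (real mat \<Rightarrow> real mat) list) \<Rightarrow> 'x \<Rightarrow> real vec" where
  "run_hooked B hooks x = output_stage B (hidden_state B hooks x (num_layers B))"

text \<open>The list of packs is in registration order: the hook of its first element runs first.\<close>

definition attach :: "inference_config \<Rightarrow> 'x decoder \<Rightarrow> 'x pack list \<Rightarrow> 'x \<Rightarrow> real vec" where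
  "attach c B ps x = run_hooked B (\<lambda>l. map (\<lambda>p. gated_hook c p x l) ps) x"

end

theory Submission
  imports Defs
begin

text \<open>A hook whose gate is closed is literally the identity: nothing is added, not even a
  computed zero, so no deviation from \<open>c\<close> can enter. Deleting the closed packs
  therefore leaves the output unchanged (\<open>attach_filter_gate\<close>), and when one gate is
  open at \<open>x\<close> the surviving list is \<open>[pack_of mstar]\<close>.\<close>

lemma fold_gated_hooks_filter:
  "fold (\<lambda>hook h. hook h) (map (\<lambda>p. gated_hook c p x l) (filter (\<lambda>p. gate p x) ps)) h =
    fold (\<lambda>hook h. hook h) (map (\<lambda>p. gated_hook c p x l) ps) h"
  by (induction ps arbitrary: h) (simp_all add: gated_hook_def)

text \<open>A gate sees the input \<open>x\<close>, never the layer or the hidden state, so one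
  filtered list serves all layers and equal states stay equal from layer to layer.\<close>

lemma hidden_state_filter_gate:
  "hidden_state B (\<lambda>l. map (\<lambda>p. gated_hook c p x l) (filter (\<lambda>p. gate p x) ps)) x l =
    hidden_state B (\<lambda>l. map (\<lambda>p. gated_hook c p x l) ps) x l"
  by (induction l) (simp_all only: hidden_state.simps fold_gated_hooks_filter)

lemma attach_filter_gate: "attach c B (filter (\<lambda>p. gate p x) ps) x = attach c B ps x"
  by (simp only: attach_def run_hooked_def hidden_state_filter_gate)

lemma filter_eq_singleton:
  assumes "distinct xs" "a \<in> set xs" "\<And>y. y \<in> set xs \<Longrightarrow> P y \<longleftrightarrow> y = a"
  shows "filter P xs = [a]"
proof -
  obtain ys zs where xs: "xs = ys @ a # zs"
    using assms(2) by (meson split_list)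
  then have "filter P ys = []" "filter P zs = []"
    using assms(1,3) by (auto simp: filter_empty_conv)
  then show ?thesis
    using xs assms(3) by simp
qed

theorem proposition2:
  fixes c :: inference_config
    and f_base :: "'x decoder"
    and M :: "'m set"
    and pack_of :: "'m \<Rightarrow> 'x pack"
    and registration :: "'m list"
    and x :: 'x
    and mstar :: 'm
  assumes "wf_decoder f_base"
    and "finite M"
    and "\<forall>m\<in>M. wf_pack (num_layers f_base) (width f_base) (pack_of m)"
    and "set registration = M" and "distinct registration"
    and "mstar \<in> M" and "gate (pack_of mstar) x"
    and "\<forall>m\<in>M - {mstar}. \<not> gate (pack_of m) x"
  shows "attach c f_base (map pack_of registration) x = attach c f_base [pack_of mstar] x"
proof -
  \<comment> \<open>Filtering is done on indices, not packs: \<open>pack_of\<close> may fail to be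
    injective, so only \<open>registration\<close> is known to be \<open>distinct\<close>.\<close>
  have "filter (\<lambda>m. gate (pack_of m) x) registration = [mstar]"
    using assms by (intro filter_eq_singleton) auto
  then have "filter (\<lambda>p. gate p x) (map pack_of registration) = [pack_of mstar]"
    by (simp add: filter_map comp_def)
  then show ?thesis
    \<comment> \<open>The lemma is applied to the full list of packs, whose filtered form is the
      singleton just found.\<close>
    by (metis attach_filter_gate)
qed

end
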